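(* Let $\alpha\in(0,1)$, let $\epsilon>0$, and let $(\epsilon_n)_{n\in\mathbb{N}}$ be a non-decreasing sequence with $0\le \epsilon_n<\epsilon$ for all $n$ and $\epsilon_n\to\epsilon$. Let $(U_n)$, $(L_n)$ be the boundaries recursively constructed from $\alpha$ and $(\epsilon_n)$, and let $\tau$ be the associated stopping time, as defined in the context. Suppose that $\epsilon<1/2$ and $\log(\epsilon_n-\epsilon_{n-1})=o(n)$ as $n\to\infty$. Then $U_n-\alpha n=o(n)$ and $\alpha n-L_n=o(n)$ as $n\to\infty$, and $\mathrm{E}_p(\tau)<\infty$ for all $p\in[0,1]$ with $p\neq\alpha$. Furthermore, $$\sup_{p\in[0,\alpha]}\mathrm{P}_p(\tau<\infty,\ S_\tau\ge U_\tau)\le\epsilon\quad\text{and}\quad \sup_{p\in(\alpha,1]}\mathrm{P}_p(\tau<\infty,\ S_\tau\le L_\tau)\le\epsilon.$$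
   Context: Notation: $\mathbb{N}=\{1,2,\dots\}$. For $p\in[0,1]$, under $\mathrm{P}_p$ (with expectation $\mathrm{E}_p$) the random variables $X_1,X_2,\dots$ are independent and identically Bernoulli distributed with parameter $p$, and $S_n=\sum_{i=1}^n X_i$. Given integer sequences $(U_n)_{n\in\mathbb{N}}$, $(L_n)_{n\in\mathbb{N}}$, the stopping time is $$\tau=\inf\{k\in\mathbb{N}: S_k\ge U_k \text{ or } S_k\le L_k\}\qquad(\inf\emptyset=\infty).$$ Construction of the boundaries from the threshold $\alpha$ and the spending sequence $(\epsilon_n)$: set $U_1=2$, $L_1=-1$ and, recursively for $n\in\{2,3,\dots\}$, $$U_n=\min\{j\in\mathbb{N}: \mathrm{P}_\alpha(\tau\ge n,\ S_n\ge j)+\mathrm{P}_\alpha(\tau<n,\ S_\tau\ge U_\tau)\le\epsilon_n\},$$ $$L_n=\max\{j\in\mathbb{Z}: \mathrm{P}_\alpha(\tau\ge n,\ S_n\le j)+\mathrm{P}_\alpha(\tau<n,\ S_\tau\le L_\tau)\le\epsilon_n\}.$$ The events $\{\tau\ge n\}$ and $\{\tau<n\}$ and the value of $S_\tau$ on $\{\tau<n\}$ depend only on $U_1,\dots,U_{n-1}$ and $L_1,\dots,L_{n-1}$, so the recursion makes sense. Convention: $\log 0=-\infty$, so the condition $\log(\epsilon_n-\epsilon_{n-1})=o(n)$ includes that $\epsilon_n>\epsilon_{n-1}$ for all sufficiently large $n$. *)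

theory Defs
  imports "HOL-Probability.Probability"
begin

text \<open>
  Sequences are indexed by \<open>{1, 2, \<dots>}\<close>; the value at index \<open>0\<close> is never inspected.
  Bernoulli variables are \<open>bool\<close>-valued, as for \<^const>\<open>bernoulli_pmf\<close>,
  and are turned into 0/1 values by \<^const>\<open>of_bool\<close>.
\<close>

definition S :: "(nat \<Rightarrow> 'a \<Rightarrow> bool) \<Rightarrow> nat \<Rightarrow> 'a \<Rightarrow> int" where
  "S X n \<omega> = (\<Sum>i=1..n. of_bool (X i \<omega>))"

definition tau ::
  "(nat \<Rightarrow> 'a \<Rightarrow> bool) \<Rightarrow> (nat \<Rightarrow> int) \<Rightarrow> (nat \<Rightarrow> int) \<Rightarrow> 'a \<Rightarrow> enat" where
  "tau X U L \<omega> = Inf (enat ` {k. 1 \<le> k \<and> (S X k \<omega> \<ge> U k \<or> S X k \<omega> \<le> L k)})"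

text \<open>Only meaningful where the stopping time is finite.\<close>

definition S_tau ::
  "(nat \<Rightarrow> 'a \<Rightarrow> bool) \<Rightarrow> (nat \<Rightarrow> int) \<Rightarrow> (nat \<Rightarrow> int) \<Rightarrow> 'a \<Rightarrow> int" where
  "S_tau X U L \<omega> = S X (the_enat (tau X U L \<omega>)) \<omega>"

definition upper_stop ::
  "(nat \<Rightarrow> 'a \<Rightarrow> bool) \<Rightarrow> (nat \<Rightarrow> int) \<Rightarrow> (nat \<Rightarrow> int) \<Rightarrow> enat \<Rightarrow> 'a \<Rightarrow> bool" where
  "upper_stop X U L t \<omega> \<longleftrightarrow>
     tau X U L \<omega> < t \<and> S_tau X U L \<omega> \<ge> U (the_enat (tau X U L \<omega>))"

definition lower_stop ::
  "(nat \<Rightarrow> 'a \<Rightarrow> bool) \<Rightarrow> (nat \<Rightarrow> int) \<Rightarrow> (nat \<Rightarrow> int) \<Rightarrow> enat \<Rightarrow> 'a \<Rightarrow> bool" where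
  "lower_stop X U L t \<omega> \<longleftrightarrow>
     tau X U L \<omega> < t \<and> S_tau X U L \<omega> \<le> L (the_enat (tau X U L \<omega>))"

definition upper_spent ::
  "'a measure \<Rightarrow> (nat \<Rightarrow> 'a \<Rightarrow> bool) \<Rightarrow> (nat \<Rightarrow> int) \<Rightarrow> (nat \<Rightarrow> int) \<Rightarrow> nat \<Rightarrow> int \<Rightarrow> real" where
  "upper_spent P X U L n j =
     measure P {\<omega> \<in> space P. tau X U L \<omega> \<ge> enat n \<and> S X n \<omega> \<ge> j}
     + measure P {\<omega> \<in> space P. upper_stop X U L (enat n) \<omega>}"

definition lower_spent ::
  "'a measure \<Rightarrow> (nat \<Rightarrow> 'a \<Rightarrow> bool) \<Rightarrow> (nat \<Rightarrow> int) \<Rightarrow> (nat \<Rightarrow> int) \<Rightarrow> nat \<Rightarrow> int \<Rightarrow> real" where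
  "lower_spent P X U L n j =
     measure P {\<omega> \<in> space P. tau X U L \<omega> \<ge> enat n \<and> S X n \<omega> \<le> j}
     + measure P {\<omega> \<in> space P. lower_stop X U L (enat n) \<omega>}"

text \<open>
  The boundaries. For well-foundedness the recursion sees them only at indices below \<open>n\<close>;
  the filler values \<open>2\<close> and \<open>-1\<close> elsewhere are irrelevant, which is what the lemmas
  \<open>upper_bd_rec\<close> and \<open>lower_bd_rec\<close> below establish.
\<close>

function upper_bd :: "'a measure \<Rightarrow> (nat \<Rightarrow> 'a \<Rightarrow> bool) \<Rightarrow> (nat \<Rightarrow> real) \<Rightarrow> nat \<Rightarrow> int"
  and lower_bd :: "'a measure \<Rightarrow> (nat \<Rightarrow> 'a \<Rightarrow> bool) \<Rightarrow> (nat \<Rightarrow> real) \<Rightarrow> nat \<Rightarrow> int" where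
  "upper_bd P X e n =
     (if n \<le> 1 then 2
      else (LEAST j. 1 \<le> j \<and>
        upper_spent P X (\<lambda>k. if k < n then upper_bd P X e k else 2)
          (\<lambda>k. if k < n then lower_bd P X e k else -1) n j \<le> e n))"
| "lower_bd P X e n =
     (if n \<le> 1 then -1
      else (GREATEST j.
        lower_spent P X (\<lambda>k. if k < n then upper_bd P X e k else 2)
          (\<lambda>k. if k < n then lower_bd P X e k else -1) n j \<le> e n))"
  by pat_completeness auto
termination
  by (relation "Wellfounded.measure (case_sum (\<lambda>(P, X, e, n). n) (\<lambda>(P, X, e, n). n))") auto

declare upper_bd.simps [simp del] lower_bd.simps [simp del]

lemma tau_less_iff:
  "tau X U L \<omega> < enat n \<longleftrightarrow> (\<exists>k. 1 \<le> k \<and> k < n \<and> (S X k \<omega> \<ge> U k \<or> S X k \<omega> \<le> L k))"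
  unfolding tau_def Inf_less_iff by auto

lemma tau_eq_if_less:
  assumes "tau X U L \<omega> < enat n" and "\<And>k. k < n \<Longrightarrow> U k = U' k \<and> L k = L' k"
  shows "tau X U' L' \<omega> = tau X U L \<omega>"
proof -
  have *: "tau X U L \<omega> < enat m \<longleftrightarrow> tau X U' L' \<omega> < enat m" if "m \<le> n" for m
    unfolding tau_less_iff using assms(2) that by (metis order_less_le_trans)
  obtain t where t: "tau X U L \<omega> = enat t" "t < n"
    using assms(1) by (cases "tau X U L \<omega>") auto
  with *[of "Suc t"] *[of t] show ?thesis
    by (cases "tau X U' L' \<omega>") auto
qed

lemma spent_cong:
  assumes eq: "\<And>k. k < n \<Longrightarrow> U k = U' k \<and> L k = L' k"
  shows "upper_spent P X U L n j = upper_spent P X U' L' n j"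
    and "lower_spent P X U L n j = lower_spent P X U' L' n j"
proof -
  have lt: "tau X U L \<omega> < enat n \<longleftrightarrow> tau X U' L' \<omega> < enat n" for \<omega>
    unfolding tau_less_iff using eq by metis
  then have ge: "tau X U L \<omega> \<ge> enat n \<longleftrightarrow> tau X U' L' \<omega> \<ge> enat n" for \<omega>
    by (metis not_less)
  have same: "tau X U' L' \<omega> = tau X U L \<omega> \<and> the_enat (tau X U L \<omega>) < n"
    if "tau X U L \<omega> < enat n" for \<omega>
    using tau_eq_if_less[OF that eq] that by (cases "tau X U L \<omega>") auto
  have "upper_stop X U L (enat n) \<omega> \<longleftrightarrow> upper_stop X U' L' (enat n) \<omega>" for \<omega>
    unfolding upper_stop_def S_tau_def using lt same eq by metis
  then show "upper_spent P X U L n j = upper_spent P X U' L' n j"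
    unfolding upper_spent_def ge by simp
  have "lower_stop X U L (enat n) \<omega> \<longleftrightarrow> lower_stop X U' L' (enat n) \<omega>" for \<omega>
    unfolding lower_stop_def S_tau_def using lt same eq by metis
  then show "lower_spent P X U L n j = lower_spent P X U' L' n j"
    unfolding lower_spent_def ge by simp
qed

lemma upper_bd_1: "upper_bd P X e 1 = 2" and lower_bd_1: "lower_bd P X e 1 = -1"
  by (simp_all add: upper_bd.simps lower_bd.simps)

lemma upper_bd_rec:
  assumes "n \<ge> 2"
  shows "upper_bd P X e n =
    (LEAST j. 1 \<le> j \<and> upper_spent P X (upper_bd P X e) (lower_bd P X e) n j \<le> e n)"
proof -
  have "upper_spent P X (\<lambda>k. if k < n then upper_bd P X e k else 2)
          (\<lambda>k. if k < n then lower_bd P X e k else -1) n j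
        = upper_spent P X (upper_bd P X e) (lower_bd P X e) n j" for j
    by (rule spent_cong) simp
  with assms show ?thesis by (subst upper_bd.simps) simp
qed

lemma lower_bd_rec:
  assumes "n \<ge> 2"
  shows "lower_bd P X e n =
    (GREATEST j. lower_spent P X (upper_bd P X e) (lower_bd P X e) n j \<le> e n)"
proof -
  have "lower_spent P X (\<lambda>k. if k < n then upper_bd P X e k else 2)
          (\<lambda>k. if k < n then lower_bd P X e k else -1) n j
        = lower_spent P X (upper_bd P X e) (lower_bd P X e) n j" for j
    by (rule spent_cong) simp
  with assms show ?thesis by (subst lower_bd.simps) simp
qed

end

theory Submission
  imports Defs
begin

text \<open>
  By construction at most \<open>e n\<close> has been spent on either boundary up to time \<open>n\<close>, so under \<open>\<alpha>\<close> the
  walk survives with probability at least \<open>1 - 2 * \<epsilon> > 0\<close>, which forces \<open>L n < U n\<close>. Hoeffding's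
  inequality shows that crossing \<open>(\<alpha> + d) * n\<close> costs at most \<open>exp (-2 * d\<^sup>2 * n)\<close>, which is eventually
  below the newly available \<open>e n - e (n - 1)\<close>; hence \<open>U n\<close> is at most \<open>(\<alpha> + d) * n\<close> up to rounding,
  and symmetrically for \<open>L n\<close>. Together with \<open>L n < U n\<close> this pins down both boundaries. For
  \<open>p \<noteq> \<alpha>\<close> a boundary of slope \<open>\<alpha>\<close> is missed with exponentially small probability, so the
  expectation of the stopping time is finite. The error bounds hold at \<open>\<alpha>\<close> by construction and
  extend to other \<open>p\<close> by a monotone coupling of the coin tosses.
\<close>

section \<open>Stopping events in terms of the path of the walk\<close>

lemma tau_ge_iff:
  "enat n \<le> tau X U L \<omega> \<longleftrightarrow> (\<forall>k. 1 \<le> k \<and> k < n \<longrightarrow> L k < S X k \<omega> \<and> S X k \<omega> < U k)"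
  using tau_less_iff[of X U L \<omega> n] by (auto simp: not_less[symmetric])

lemma tau_eq_enatD:
  assumes "tau X U L \<omega> = enat t"
  shows "1 \<le> t" and "S X t \<omega> \<ge> U t \<or> S X t \<omega> \<le> L t"
    and "\<And>k. 1 \<le> k \<Longrightarrow> k < t \<Longrightarrow> L k < S X k \<omega> \<and> S X k \<omega> < U k"
proof -
  have *: "L k < S X k \<omega> \<and> S X k \<omega> < U k" if "1 \<le> k" "k < t" for k
    using tau_ge_iff[of t X U L \<omega>] assms that by auto
  moreover have "tau X U L \<omega> < enat (Suc t)"
    using assms by simp
  then obtain k where "1 \<le> k" "k < Suc t" "S X k \<omega> \<ge> U k \<or> S X k \<omega> \<le> L k"
    unfolding tau_less_iff by blast
  ultimately have "k = t"
    by (metis less_antisym not_less)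
  with \<open>1 \<le> k\<close> \<open>S X k \<omega> \<ge> U k \<or> S X k \<omega> \<le> L k\<close>
  show "1 \<le> t" "S X t \<omega> \<ge> U t \<or> S X t \<omega> \<le> L t"
    by auto
  show "\<And>k. 1 \<le> k \<Longrightarrow> k < t \<Longrightarrow> L k < S X k \<omega> \<and> S X k \<omega> < U k"
    by (fact *)
qed

text \<open>Not requiring the walk to stay below the upper boundary before time \<open>k\<close> leaves the event
  unchanged, and in this form it is evident that the event is increasing in the walk.\<close>

lemma upper_stop_iff:
  "upper_stop X U L t \<omega> \<longleftrightarrow>
    (\<exists>k. 1 \<le> k \<and> enat k < t \<and> S X k \<omega> \<ge> U k \<and> (\<forall>j. 1 \<le> j \<and> j < k \<longrightarrow> L j < S X j \<omega>))"
    (is "_ \<longleftrightarrow> (\<exists>k. ?Q k)")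
proof
  assume *: "upper_stop X U L t \<omega>"
  then obtain k where k: "tau X U L \<omega> = enat k"
    unfolding upper_stop_def by (cases "tau X U L \<omega>") auto
  with * have "?Q k"
    using tau_eq_enatD[OF k] by (auto simp: upper_stop_def S_tau_def)
  then show "\<exists>k. ?Q k" ..
next
  assume "\<exists>k. ?Q k"
  then obtain k where k: "?Q k" ..
  then have "tau X U L \<omega> < enat (Suc k)"
    unfolding tau_less_iff by (intro exI[of _ k]) auto
  then obtain l where l: "tau X U L \<omega> = enat l" "l \<le> k"
    by (cases "tau X U L \<omega>") auto
  have "S X l \<omega> \<ge> U l"
    using tau_eq_enatD[OF l(1)] k l(2) by (cases "l = k") force+
  moreover have "enat l < t"
    using l(2) k by (meson enat_ord_simps(1) le_less_trans)
  ultimately show "upper_stop X U L t \<omega>"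
    by (simp add: upper_stop_def S_tau_def l(1))
qed

lemma lower_stop_iff:
  "lower_stop X U L t \<omega> \<longleftrightarrow>
    (\<exists>k. 1 \<le> k \<and> enat k < t \<and> S X k \<omega> \<le> L k \<and> (\<forall>j. 1 \<le> j \<and> j < k \<longrightarrow> S X j \<omega> < U j))"
    (is "_ \<longleftrightarrow> (\<exists>k. ?Q k)")
proof
  assume *: "lower_stop X U L t \<omega>"
  then obtain k where k: "tau X U L \<omega> = enat k"
    unfolding lower_stop_def by (cases "tau X U L \<omega>") auto
  with * have "?Q k"
    using tau_eq_enatD[OF k] by (auto simp: lower_stop_def S_tau_def)
  then show "\<exists>k. ?Q k" ..
next
  assume "\<exists>k. ?Q k"
  then obtain k where k: "?Q k" ..
  then have "tau X U L \<omega> < enat (Suc k)"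
    unfolding tau_less_iff by (intro exI[of _ k]) auto
  then obtain l where l: "tau X U L \<omega> = enat l" "l \<le> k"
    by (cases "tau X U L \<omega>") auto
  have "S X l \<omega> \<le> L l"
    using tau_eq_enatD[OF l(1)] k l(2) by (cases "l = k") force+
  moreover have "enat l < t"
    using l(2) k by (meson enat_ord_simps(1) le_less_trans)
  ultimately show "lower_stop X U L t \<omega>"
    by (simp add: lower_stop_def S_tau_def l(1))
qed

text \<open>Both alternatives may hold at once, since nothing here separates \<open>L k\<close> from
  \<open>U k\<close>; this is why a union bound is used in
  \<open>one_le_prob_upper_lower\<close>.\<close>

lemma upper_or_lower_stop:
  assumes "tau X U L \<omega> < t"
  shows "upper_stop X U L t \<omega> \<or> lower_stop X U L t \<omega>"
proof -
  obtain k where k: "tau X U L \<omega> = enat k"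
    using assms by (cases "tau X U L \<omega>") auto
  show ?thesis
    using assms tau_eq_enatD(2)[OF k] by (auto simp: upper_stop_def lower_stop_def S_tau_def k)
qed

lemma tau_eq_enatI:
  assumes "enat n \<le> tau X U L \<omega>" and "1 \<le> n" and "S X n \<omega> \<ge> U n \<or> S X n \<omega> \<le> L n"
  shows "tau X U L \<omega> = enat n"
proof -
  have "tau X U L \<omega> < enat (Suc n)"
    unfolding tau_less_iff using assms(2,3) by (intro exI[of _ n]) auto
  with assms(1) show ?thesis
    by (cases "tau X U L \<omega>") auto
qed

text \<open>The split mirrors the two summands of \<open>upper_spent\<close>, which
  \<open>prob_upper_stop_Suc\<close> exploits.\<close>

lemma upper_stop_Suc_iff:
  assumes "1 \<le> n"
  shows "upper_stop X U L (enat (Suc n)) \<omega> \<longleftrightarrow>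
    upper_stop X U L (enat n) \<omega> \<or> enat n \<le> tau X U L \<omega> \<and> S X n \<omega> \<ge> U n"
  using tau_eq_enatI[OF _ assms, of X U L \<omega>]
  by (cases "tau X U L \<omega>") (auto simp: upper_stop_def S_tau_def less_Suc_eq)

lemma lower_stop_Suc_iff:
  assumes "1 \<le> n"
  shows "lower_stop X U L (enat (Suc n)) \<omega> \<longleftrightarrow>
    lower_stop X U L (enat n) \<omega> \<or> enat n \<le> tau X U L \<omega> \<and> S X n \<omega> \<le> L n"
  using tau_eq_enatI[OF _ assms, of X U L \<omega>]
  by (cases "tau X U L \<omega>") (auto simp: lower_stop_def S_tau_def less_Suc_eq)

text \<open>A higher walk also reaches \<open>U\<close> at time \<open>k\<close> and also avoids
  \<open>L\<close> before it. The two walks may live on different spaces: equal walks transfer the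
  event to another space, ordered walks give monotonicity in the success probability.\<close>

lemma upper_stop_mono:
  assumes "\<And>k. enat k < t \<Longrightarrow> S X k \<omega> \<le> S Y k \<eta>" and "upper_stop X U L t \<omega>"
  shows "upper_stop Y U L t \<eta>"
proof -
  obtain k where k: "1 \<le> k" "enat k < t" "S X k \<omega> \<ge> U k" "\<forall>j. 1 \<le> j \<and> j < k \<longrightarrow> L j < S X j \<omega>"
    using assms(2) unfolding upper_stop_iff by blast
  have le: "S X j \<omega> \<le> S Y j \<eta>" if "j \<le> k" for j
    using assms(1)[of j] k(2) that by (meson enat_ord_simps(1) le_less_trans)
  have "U k \<le> S Y k \<eta>"
    using k(3) le[of k] by simp
  moreover have "L j < S Y j \<eta>" if "1 \<le> j" "j < k" for j
    using k(4)[rule_format, of j] le[of j] that by simp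
  ultimately show ?thesis
    unfolding upper_stop_iff using k(1,2) by blast
qed

lemma lower_stop_mono:
  assumes "\<And>k. enat k < t \<Longrightarrow> S Y k \<eta> \<le> S X k \<omega>" and "lower_stop X U L t \<omega>"
  shows "lower_stop Y U L t \<eta>"
proof -
  obtain k where k: "1 \<le> k" "enat k < t" "S X k \<omega> \<le> L k" "\<forall>j. 1 \<le> j \<and> j < k \<longrightarrow> S X j \<omega> < U j"
    using assms(2) unfolding lower_stop_iff by blast
  have le: "S Y j \<eta> \<le> S X j \<omega>" if "j \<le> k" for j
    using assms(1)[of j] k(2) that by (meson enat_ord_simps(1) le_less_trans)
  have "S Y k \<eta> \<le> L k"
    using k(3) le[of k] by simp
  moreover have "S Y j \<eta> < U j" if "1 \<le> j" "j < k" for j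
    using k(4)[rule_format, of j] le[of j] that by simp
  ultimately show ?thesis
    unfolding lower_stop_iff using k(1,2) by blast
qed

section \<open>Range of the walk and extremal integers\<close>

lemma S_nonneg: "0 \<le> S X n \<omega>"
  unfolding S_def by (intro sum_nonneg) auto

lemma S_le: "S X n \<omega> \<le> int n"
proof -
  have "S X n \<omega> \<le> (\<Sum>i=1..n. 1)"
    unfolding S_def by (intro sum_mono) auto
  then show ?thesis by simp
qed

lemma S_mono:
  assumes "\<And>i. 1 \<le> i \<Longrightarrow> i \<le> n \<Longrightarrow> X i \<omega> \<Longrightarrow> Y i \<eta>"
  shows "S X n \<omega> \<le> S Y n \<eta>"
  unfolding S_def using assms by (intro sum_mono) auto

text \<open>The integers are not well-ordered, so \<open>LEAST\<close> needs a lower bound to be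
  attained; shifting by \<open>a\<close> reduces the claim to the naturals.\<close>

lemma int_LeastI:
  fixes P :: "int \<Rightarrow> bool"
  assumes "P k" and bound: "\<And>j. P j \<Longrightarrow> a \<le> j"
  shows "P (LEAST j. P j)" and "(LEAST j. P j) \<le> k"
proof -
  define m where "m = (LEAST i. P (a + int i))"
  have "P (a + int (nat (k - a)))"
    using assms bound[OF assms(1)] by simp
  then have m: "P (a + int m)"
    unfolding m_def by (rule LeastI)
  have least: "a + int m \<le> j" if "P j" for j
  proof -
    have "P (a + int (nat (j - a)))"
      using that bound[OF that] by simp
    then have "m \<le> nat (j - a)"
      unfolding m_def by (rule Least_le)
    then show ?thesis
      using bound[OF that] by linarith
  qed
  have eq: "(LEAST j. P j) = a + int m"
    by (rule Least_equality) (use m least in auto)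
  show "P (LEAST j. P j)" "(LEAST j. P j) \<le> k"
    unfolding eq using m least assms(1) by auto
qed

lemma int_GreatestI:
  fixes P :: "int \<Rightarrow> bool"
  assumes "P k" and bound: "\<And>j. P j \<Longrightarrow> j \<le> b"
  shows "P (GREATEST j. P j)" and "k \<le> (GREATEST j. P j)"
proof -
  let ?m = "LEAST j. P (- j)"
  have bound': "- b \<le> j" if "P (- j)" for j
    using bound[OF that] by simp
  have m: "P (- ?m)" and least: "- ?m \<ge> j" if "P j" for j
    using int_LeastI[where P = "\<lambda>j. P (- j)", of "- j", OF _ bound'] that by fastforce+
  have eq: "(GREATEST j. P j) = - ?m"
    by (rule Greatest_equality) (use m least assms(1) in auto)
  show "P (GREATEST j. P j)" "k \<le> (GREATEST j. P j)"
    unfolding eq using m least assms(1) by auto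
qed

text \<open>Monotone coupling: toss a \<open>q\<close>-coin and an independent
  \<open>p / q\<close>-coin. Their conjunction is a \<open>p\<close>-coin that never exceeds the
  \<open>q\<close>-coin, so increasing events gain probability from \<open>p\<close> to
  \<open>q\<close> and decreasing ones lose it.\<close>

lemma Pi_pmf_bernoulli_mono:
  fixes p q :: real
  assumes pq: "0 \<le> p" "p \<le> q" "q \<le> 1" and "finite I"
  defines "coins \<equiv> \<lambda>r. Pi_pmf I False (\<lambda>_. bernoulli_pmf r)"
  shows "(\<And>f g. (\<And>i. f i \<Longrightarrow> g i) \<Longrightarrow> f \<in> A \<Longrightarrow> g \<in> A) \<Longrightarrow>
      measure_pmf.prob (coins p) A \<le> measure_pmf.prob (coins q) A"
    and "(\<And>f g. (\<And>i. f i \<Longrightarrow> g i) \<Longrightarrow> g \<in> A \<Longrightarrow> f \<in> A) \<Longrightarrow>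
      measure_pmf.prob (coins q) A \<le> measure_pmf.prob (coins p) A"
proof -
  define K where "K = pair_pmf (bernoulli_pmf q) (bernoulli_pmf (p / q))"
  \<comment> \<open>The default pair is mapped to \<open>False\<close> by both conjunction and
    \<open>fst\<close>, as \<open>Pi_pmf_map\<close> requires.\<close>
  define C where "C = Pi_pmf I (False, False) (\<lambda>_. K)"
  \<comment> \<open>If \<open>q = 0\<close>, then \<open>p = 0\<close> and \<open>p / q\<close> is
    \<open>0\<close> by convention, so the construction also covers this case.\<close>
  have r: "0 \<le> p / q" "p / q \<le> 1"
    using pq by (auto simp: field_simps divide_le_eq_1)
  have "map_pmf (\<lambda>(a, b). a \<and> b) K = bernoulli_pmf p"
  proof (rule pmf_eqI)
    fix x
    have T: "pmf (map_pmf (\<lambda>(a, b). a \<and> b) K) True = p"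
    proof -
      have "(\<lambda>(a, b). a \<and> b) -` {True} = {(True, True)}" by auto
      then have "pmf (map_pmf (\<lambda>(a, b). a \<and> b) K) True = q * (p / q)"
        using pq r by (simp add: pmf_map measure_pmf_single K_def pmf_pair)
      then show ?thesis using pq by auto
    qed
    then show "pmf (map_pmf (\<lambda>(a, b). a \<and> b) K) x = pmf (bernoulli_pmf p) x"
      using pq by (cases x) (simp_all add: pmf_False_conv_True)
  qed
  then have p: "coins p = map_pmf (\<lambda>h. (\<lambda>(a, b). a \<and> b) \<circ> h) C"
    unfolding coins_def C_def using \<open>finite I\<close> by (subst Pi_pmf_map[symmetric]) auto
  have "map_pmf fst K = bernoulli_pmf q"
    by (simp add: K_def map_fst_pair_pmf)
  then have q: "coins q = map_pmf (\<lambda>h. fst \<circ> h) C"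
    unfolding coins_def C_def using \<open>finite I\<close> by (subst Pi_pmf_map[symmetric]) auto
  show "measure_pmf.prob (coins p) A \<le> measure_pmf.prob (coins q) A"
    if up: "\<And>f g. (\<And>i. f i \<Longrightarrow> g i) \<Longrightarrow> f \<in> A \<Longrightarrow> g \<in> A"
    unfolding p q measure_map_pmf
  proof (intro measure_pmf.finite_measure_mono vimageI2 subsetI)
    fix h assume "h \<in> (\<lambda>h. (\<lambda>(a, b). a \<and> b) \<circ> h) -` A"
    then show "fst \<circ> h \<in> A"
      by (intro up[of "(\<lambda>(a, b). a \<and> b) \<circ> h" "fst \<circ> h"]) (auto simp: case_prod_beta)
  qed simp
  show "measure_pmf.prob (coins q) A \<le> measure_pmf.prob (coins p) A"
    if down: "\<And>f g. (\<And>i. f i \<Longrightarrow> g i) \<Longrightarrow> g \<in> A \<Longrightarrow> f \<in> A"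
    unfolding p q measure_map_pmf
  proof (intro measure_pmf.finite_measure_mono vimageI2 subsetI)
    fix h :: "'a \<Rightarrow> bool \<times> bool" assume "h \<in> (\<lambda>h. fst \<circ> h) -` A"
    then show "(\<lambda>(a, b). a \<and> b) \<circ> h \<in> A"
      by (intro down[of "(\<lambda>(a, b). a \<and> b) \<circ> h" "fst \<circ> h"]) (auto simp: case_prod_beta)
  qed simp
qed

section \<open>One Bernoulli process: measurability, concentration, law of finitely many
  tosses\<close>

locale bernoulli_process = prob_space P for P :: "'a measure" +
  fixes X :: "nat \<Rightarrow> 'a \<Rightarrow> bool" and p :: real
  assumes p: "p \<in> {0..1}"
    and indep: "indep_vars (\<lambda>_. count_space UNIV) X {1..}"
    and bernoulli: "\<And>i. i \<ge> 1 \<Longrightarrow> distr P (count_space UNIV) (X i) = measure_pmf (bernoulli_pmf p)"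
begin

lemma X_measurable: "i \<ge> 1 \<Longrightarrow> X i \<in> measurable P (count_space UNIV)"
  using indep unfolding indep_vars_def by auto

lemma S_measurable [measurable]: "S X n \<in> measurable P (count_space UNIV)"
proof -
  have "(\<lambda>\<omega>. \<Sum>i=1..n. of_bool (X i \<omega>) :: int) \<in> measurable P (count_space UNIV)"
  proof (induction n)
    case (Suc n)
    \<comment> \<open>Split along the two values of the new toss; for each of them the sum is a
      function of the previous partial sum alone.\<close>
    have "(\<lambda>\<omega>. (\<Sum>i=1..n. of_bool (X i \<omega>) :: int) + of_bool (X (Suc n) \<omega>))
        \<in> measurable P (count_space UNIV)"
      by (rule measurable_compose_countable[OF measurable_compose[OF Suc] X_measurable]) auto
    then show ?case by (simp del: sum_of_bool_eq)
  qed simp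
  then show ?thesis by (simp add: S_def [abs_def])
qed

lemma tau_ge_pred [measurable]: "Measurable.pred P (\<lambda>\<omega>. enat n \<le> tau X U L \<omega>)"
  unfolding tau_ge_iff by measurable

lemma upper_stop_pred [measurable]: "Measurable.pred P (upper_stop X U L t)"
  unfolding upper_stop_iff [abs_def] by measurable

lemma lower_stop_pred [measurable]: "Measurable.pred P (lower_stop X U L t)"
  unfolding lower_stop_iff [abs_def] by measurable

lemma prob_X: "i \<ge> 1 \<Longrightarrow> prob (X i -` {b} \<inter> space P) = pmf (bernoulli_pmf p) b"
  using bernoulli[of i] X_measurable[of i]
  by (subst measure_distr[symmetric, of _ _ "count_space UNIV"]) (auto simp: measure_pmf_single)

lemma expectation_X:
  assumes "i \<ge> 1"
  shows "expectation (\<lambda>\<omega>. of_bool (X i \<omega>)) = p"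
proof -
  have "expectation (\<lambda>\<omega>. of_bool (X i \<omega>) :: real) =
      (\<integral>b. of_bool b \<partial>distr P (count_space UNIV) (X i))"
    using X_measurable[OF assms] by (subst integral_distr) auto
  also have "\<dots> = p"
    using p by (simp add: bernoulli[OF assms])
  finally show ?thesis .
qed

lemma Hoeffding_S:
  assumes "n \<ge> 1" and "d \<ge> 0"
  shows "prob {\<omega> \<in> space P. real_of_int (S X n \<omega>) \<ge> (p + d) * n} \<le> exp (- 2 * d\<^sup>2 * n)"
    and "prob {\<omega> \<in> space P. real_of_int (S X n \<omega>) \<le> (p - d) * n} \<le> exp (- 2 * d\<^sup>2 * n)"
proof -
  interpret H: Hoeffding_ineq P "{1..n}" "\<lambda>i \<omega>. of_bool (X i \<omega>)" "\<lambda>_. 0" "\<lambda>_. 1" "n * p"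
  proof unfold_locales
    show "indep_vars (\<lambda>_. borel) (\<lambda>i \<omega>. of_bool (X i \<omega>) :: real) {1..n}"
      by (rule indep_vars_compose2[OF indep_vars_subset[OF indep]]) auto
  qed (auto simp: expectation_X)
  have S: "(\<Sum>i=1..n. of_bool (X i \<omega>)) = real_of_int (S X n \<omega>)" for \<omega>
    by (simp add: S_def)
  have "d * n \<ge> 0" "(\<Sum>i=1..n. (1 - 0 :: real)\<^sup>2) > 0"
    using assms by auto
  note H = H.Hoeffding_ineq_ge[OF this] H.Hoeffding_ineq_le[OF this]
  \<comment> \<open>Each toss lies in an interval of width 1, so the squared widths add up to
    \<open>n\<close> and cancel one factor of \<open>n\<close> in the exponent.\<close>
  have e: "- 2 * (d * n)\<^sup>2 / (\<Sum>i=1..n. (1 - 0 :: real)\<^sup>2) = - 2 * d\<^sup>2 * n"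
    using assms by (simp add: power2_eq_square)
  have *: "(p + d) * n = n * p + d * n" "(p - d) * n = n * p - d * n"
    by (simp_all add: algebra_simps)
  show "prob {\<omega> \<in> space P. real_of_int (S X n \<omega>) \<ge> (p + d) * n} \<le> exp (- 2 * d\<^sup>2 * n)"
    using H(1) unfolding e S * .
  show "prob {\<omega> \<in> space P. real_of_int (S X n \<omega>) \<le> (p - d) * n} \<le> exp (- 2 * d\<^sup>2 * n)"
    using H(2) unfolding e S * .
qed

text \<open>Moves events of the first \<open>n\<close> tosses to a concrete product space, where
  different success probabilities can be coupled. The event is a disjoint union of finitely many
  cylinders, whose probabilities factor by independence. Tosses outside \<open>{1..n}\<close> are
  set to \<open>False\<close> to match the default of \<open>Pi_pmf\<close>.\<close>

lemma prob_eq_Pi_pmf: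
  assumes "n \<ge> 1"
  shows "prob {\<omega> \<in> space P. (\<lambda>i. i \<in> {1..n} \<and> X i \<omega>) \<in> A} =
    measure_pmf.prob (Pi_pmf {1..n} False (\<lambda>_. bernoulli_pmf p)) A"
proof -
  define F where "F = PiE_dflt {1..n} False (\<lambda>_. UNIV :: bool set)"
  define E where "E = (\<lambda>f. \<Inter>i\<in>{1..n}. X i -` {f i} \<inter> space P)"
  have F: "finite F"
    unfolding F_def by (rule finite_PiE_dflt) auto
  have E: "E f \<in> sets P" for f
    unfolding E_def using assms X_measurable
    by (intro sets.finite_INT) (auto intro!: measurable_sets)
  have prob_E: "prob (E f) = pmf (Pi_pmf {1..n} False (\<lambda>_. bernoulli_pmf p)) f" if "f \<in> F" for f
  proof -
    have "prob (E f) = (\<Prod>i=1..n. prob (X i -` {f i} \<inter> space P))"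
      unfolding E_def using assms by (intro indep_varsD[OF indep]) auto
    also have "\<dots> = (\<Prod>i=1..n. pmf (bernoulli_pmf p) (f i))"
      by (intro prod.cong) (auto simp: prob_X)
    also have "\<dots> = pmf (Pi_pmf {1..n} False (\<lambda>_. bernoulli_pmf p)) f"
      using that by (subst pmf_Pi') (auto simp: F_def PiE_dflt_def)
    finally show ?thesis .
  qed
  have "{\<omega> \<in> space P. (\<lambda>i. i \<in> {1..n} \<and> X i \<omega>) \<in> A} = (\<Union>f\<in>F \<inter> A. E f)"
  proof (intro equalityI subsetI)
    fix \<omega> assume "\<omega> \<in> {\<omega> \<in> space P. (\<lambda>i. i \<in> {1..n} \<and> X i \<omega>) \<in> A}"
    then show "\<omega> \<in> (\<Union>f\<in>F \<inter> A. E f)"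
      by (intro UN_I[of "\<lambda>i. i \<in> {1..n} \<and> X i \<omega>"]) (auto simp: F_def E_def PiE_dflt_def)
  next
    fix \<omega> assume "\<omega> \<in> (\<Union>f\<in>F \<inter> A. E f)"
    then obtain f where f: "f \<in> F" "f \<in> A" "\<omega> \<in> E f" by blast
    then have "X i \<omega> = f i" if "i \<in> {1..n}" for i
      using that unfolding E_def by blast
    with f(1) have "(\<lambda>i. i \<in> {1..n} \<and> X i \<omega>) = f"
      by (auto simp: F_def PiE_dflt_def fun_eq_iff)
    moreover have "\<omega> \<in> space P"
      using f(3) assms by (auto simp: E_def)
    ultimately show "\<omega> \<in> {\<omega> \<in> space P. (\<lambda>i. i \<in> {1..n} \<and> X i \<omega>) \<in> A}"
      using f by simp
  qed
  moreover have "disjoint_family_on E (F \<inter> A)"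
    unfolding disjoint_family_on_def
  proof (intro ballI impI)
    fix f g assume fg: "f \<in> F \<inter> A" "g \<in> F \<inter> A" "f \<noteq> g"
    then obtain i where "f i \<noteq> g i" by auto
    moreover have "i \<in> {1..n}"
      using fg \<open>f i \<noteq> g i\<close> by (auto simp: F_def PiE_dflt_def)
    ultimately show "E f \<inter> E g = {}"
      unfolding E_def by blast
  qed
  ultimately have "prob {\<omega> \<in> space P. (\<lambda>i. i \<in> {1..n} \<and> X i \<omega>) \<in> A} = (\<Sum>f\<in>F \<inter> A. prob (E f))"
    using F E by (simp add: finite_measure_finite_Union image_subset_iff)
  also have "\<dots> = (\<Sum>f\<in>F \<inter> A. pmf (Pi_pmf {1..n} False (\<lambda>_. bernoulli_pmf p)) f)"
    by (intro sum.cong) (auto simp: prob_E)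
  also have "\<dots> = measure_pmf.prob (Pi_pmf {1..n} False (\<lambda>_. bernoulli_pmf p)) (F \<inter> A)"
    using F by (simp add: measure_measure_pmf_finite)
  \<comment> \<open>Outcomes outside \<open>F\<close> are \<open>True\<close> somewhere off
    \<open>{1..n}\<close> and have mass zero.\<close>
  also have "\<dots> = measure_pmf.prob (Pi_pmf {1..n} False (\<lambda>_. bernoulli_pmf p)) A"
    by (intro measure_prob_cong_0) (auto simp: F_def PiE_dflt_def intro!: pmf_Pi_outside)
  finally show ?thesis .
qed

section \<open>The stopping time and the probabilities of stopping at each boundary\<close>

lemma tau_measurable: "tau X U L \<in> measurable P (count_space UNIV)"
proof -
  have "Measurable.pred P (\<lambda>\<omega>. tau X U L \<omega> = t)" for t
  proof (cases t)
    case (enat n)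
    have "tau X U L \<omega> = t \<longleftrightarrow> enat n \<le> tau X U L \<omega> \<and> \<not> enat (Suc n) \<le> tau X U L \<omega>" for \<omega>
      unfolding enat by (cases "tau X U L \<omega>") auto
    then show ?thesis by simp
  next
    case infinity
    have "tau X U L \<omega> = t \<longleftrightarrow> (\<forall>n. enat n \<le> tau X U L \<omega>)" for \<omega>
      unfolding infinity by (cases "tau X U L \<omega>") (auto, meson not_less_eq_eq order_refl)
    then show ?thesis by simp
  qed
  then show ?thesis
    by (subst measurable_count_space_eq2_countable) (auto simp: pred_def vimage_def Int_def conj_commute)
qed

text \<open>Turns the constraint that defines \<open>U n\<close> into a bound on a stopping
  probability. The two events add up because one lives on \<open>enat n \<le> tau\<close> and the
  other on \<open>tau < enat n\<close>.\<close>

lemma prob_upper_stop_Suc: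
  assumes "1 \<le> n"
  shows "prob {\<omega> \<in> space P. upper_stop X U L (enat (Suc n)) \<omega>} = upper_spent P X U L n (U n)"
proof -
  have "{\<omega> \<in> space P. upper_stop X U L (enat (Suc n)) \<omega>} =
      {\<omega> \<in> space P. enat n \<le> tau X U L \<omega> \<and> S X n \<omega> \<ge> U n} \<union>
      {\<omega> \<in> space P. upper_stop X U L (enat n) \<omega>}"
    by (auto simp: upper_stop_Suc_iff[OF assms])
  moreover have "{\<omega> \<in> space P. enat n \<le> tau X U L \<omega> \<and> S X n \<omega> \<ge> U n} \<inter>
      {\<omega> \<in> space P. upper_stop X U L (enat n) \<omega>} = {}"
    by (auto simp: upper_stop_def)
  ultimately show ?thesis
    unfolding upper_spent_def by (simp add: finite_measure_Union)
qed

lemma prob_lower_stop_Suc: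
  assumes "1 \<le> n"
  shows "prob {\<omega> \<in> space P. lower_stop X U L (enat (Suc n)) \<omega>} = lower_spent P X U L n (L n)"
proof -
  have "{\<omega> \<in> space P. lower_stop X U L (enat (Suc n)) \<omega>} =
      {\<omega> \<in> space P. enat n \<le> tau X U L \<omega> \<and> S X n \<omega> \<le> L n} \<union>
      {\<omega> \<in> space P. lower_stop X U L (enat n) \<omega>}"
    by (auto simp: lower_stop_Suc_iff[OF assms])
  moreover have "{\<omega> \<in> space P. enat n \<le> tau X U L \<omega> \<and> S X n \<omega> \<le> L n} \<inter>
      {\<omega> \<in> space P. lower_stop X U L (enat n) \<omega>} = {}"
    by (auto simp: lower_stop_def)
  ultimately show ?thesis
    unfolding lower_spent_def by (simp add: finite_measure_Union)
qed

text \<open>Continuity from below: the events of stopping at \<open>U\<close> before time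
  \<open>n\<close> increase to the event of ever doing so.\<close>

lemma prob_upper_stop_infinity_le:
  assumes "\<And>n. n \<ge> 1 \<Longrightarrow> prob {\<omega> \<in> space P. upper_stop X U L (enat (Suc n)) \<omega>} \<le> c"
  shows "prob {\<omega> \<in> space P. upper_stop X U L \<infinity> \<omega>} \<le> c"
proof -
  define A where "A = (\<lambda>n. {\<omega> \<in> space P. upper_stop X U L (enat n) \<omega>})"
  have "incseq A"
    unfolding A_def incseq_def upper_stop_def by (auto intro: less_le_trans)
  moreover have "range A \<subseteq> events"
    unfolding A_def by auto
  ultimately have "(\<lambda>n. prob (A n)) \<longlonglongrightarrow> prob (\<Union>n. A n)"
    by (intro finite_Lim_measure_incseq)
  moreover have "(\<Union>n. A n) = {\<omega> \<in> space P. upper_stop X U L \<infinity> \<omega>}"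
    unfolding A_def upper_stop_iff by auto
  moreover have "prob (A n) \<le> c" if "n \<ge> 2" for n
    using assms[of "n - 1"] that by (simp add: A_def)
  ultimately show ?thesis
    by (metis LIMSEQ_le_const2)
qed

lemma prob_lower_stop_infinity_le:
  assumes "\<And>n. n \<ge> 1 \<Longrightarrow> prob {\<omega> \<in> space P. lower_stop X U L (enat (Suc n)) \<omega>} \<le> c"
  shows "prob {\<omega> \<in> space P. lower_stop X U L \<infinity> \<omega>} \<le> c"
proof -
  define A where "A = (\<lambda>n. {\<omega> \<in> space P. lower_stop X U L (enat n) \<omega>})"
  have "incseq A"
    unfolding A_def incseq_def lower_stop_def by (auto intro: less_le_trans)
  moreover have "range A \<subseteq> events"
    unfolding A_def by auto
  ultimately have "(\<lambda>n. prob (A n)) \<longlonglongrightarrow> prob (\<Union>n. A n)"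
    by (intro finite_Lim_measure_incseq)
  moreover have "(\<Union>n. A n) = {\<omega> \<in> space P. lower_stop X U L \<infinity> \<omega>}"
    unfolding A_def lower_stop_iff by auto
  moreover have "prob (A n) \<le> c" if "n \<ge> 2" for n
    using assms[of "n - 1"] that by (simp add: A_def)
  ultimately show ?thesis
    by (metis LIMSEQ_le_const2)
qed

text \<open>Stopping before \<open>Suc n\<close> depends on the first \<open>n\<close> tosses only;
  both directions are \<open>upper_stop_mono\<close> applied to walks that agree up to
  \<open>n\<close>.\<close>

lemma prob_upper_stop_eq_Pi_pmf:
  assumes "n \<ge> 1"
  shows "prob {\<omega> \<in> space P. upper_stop X U L (enat (Suc n)) \<omega>} =
    measure_pmf.prob (Pi_pmf {1..n} False (\<lambda>_. bernoulli_pmf p))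
      {f. upper_stop (\<lambda>i f. f i) U L (enat (Suc n)) f}"
proof -
  have S: "S X k \<omega> = S (\<lambda>i f. f i) k (\<lambda>i. i \<in> {1..n} \<and> X i \<omega>)" if "k \<le> n" for k \<omega>
    unfolding S_def using that by (intro sum.cong) auto
  have "upper_stop X U L (enat (Suc n)) \<omega> \<longleftrightarrow>
      upper_stop (\<lambda>i f. f i) U L (enat (Suc n)) (\<lambda>i. i \<in> {1..n} \<and> X i \<omega>)" for \<omega>
    using S by (intro iffI; elim upper_stop_mono[rotated]) auto
  then show ?thesis
    by (subst prob_eq_Pi_pmf[OF assms, symmetric]) simp
qed

lemma prob_lower_stop_eq_Pi_pmf:
  assumes "n \<ge> 1"
  shows "prob {\<omega> \<in> space P. lower_stop X U L (enat (Suc n)) \<omega>} =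
    measure_pmf.prob (Pi_pmf {1..n} False (\<lambda>_. bernoulli_pmf p))
      {f. lower_stop (\<lambda>i f. f i) U L (enat (Suc n)) f}"
proof -
  have S: "S X k \<omega> = S (\<lambda>i f. f i) k (\<lambda>i. i \<in> {1..n} \<and> X i \<omega>)" if "k \<le> n" for k \<omega>
    unfolding S_def using that by (intro sum.cong) auto
  have "lower_stop X U L (enat (Suc n)) \<omega> \<longleftrightarrow>
      lower_stop (\<lambda>i f. f i) U L (enat (Suc n)) (\<lambda>i. i \<in> {1..n} \<and> X i \<omega>)" for \<omega>
    using S by (intro iffI; elim lower_stop_mono[rotated]) auto
  then show ?thesis
    by (subst prob_eq_Pi_pmf[OF assms, symmetric]) simp
qed

text \<open>The expectation of \<open>tau\<close> is the sum of its tail probabilities, which a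
  geometric series eventually dominates.\<close>

lemma expectation_tau_finite:
  fixes c :: real
  assumes "c > 0"
    and "\<forall>\<^sub>F n in sequentially. prob {\<omega> \<in> space P. enat n < tau X U L \<omega>} \<le> exp (- c * real n)"
  shows "(\<integral>\<^sup>+ \<omega>. ennreal_of_enat (tau X U L \<omega>) \<partial>P) < \<infinity>"
proof -
  define r where "r = (\<lambda>n. prob {\<omega> \<in> space P. enat n < tau X U L \<omega>})"
  have "summable (\<lambda>n. exp (- c) ^ n)"
    using assms(1) by (intro summable_geometric) simp
  also have "(\<lambda>n. exp (- c) ^ n) = (\<lambda>n. exp (- c * real n))"
    by (simp add: exp_of_nat_mult[symmetric] mult.commute)
  finally have "summable r"
    by (rule summable_comparison_test_ev[rotated])
       (use assms(2) in \<open>auto simp: r_def elim: eventually_mono\<close>)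
  have "(\<integral>\<^sup>+ \<omega>. ennreal_of_enat (tau X U L \<omega>) \<partial>P) = (\<Sum>n. ennreal (r n))"
    by (subst nn_integral_enat_function[OF tau_measurable]) (simp add: r_def emeasure_eq_measure)
  also have "\<dots> = ennreal (\<Sum>n. r n)"
    using \<open>summable r\<close> by (intro suminf_ennreal2) (auto simp: r_def)
  finally show ?thesis
    by simp
qed

end

section \<open>Comparison of stopping probabilities for different parameters\<close>

lemma prob_upper_stop_mono:
  assumes "bernoulli_process P X p" and "bernoulli_process Q X q" and "p \<le> q" and "n \<ge> 1"
  shows "measure P {\<omega> \<in> space P. upper_stop X U L (enat (Suc n)) \<omega>} \<le>
    measure Q {\<omega> \<in> space Q. upper_stop X U L (enat (Suc n)) \<omega>}"
proof -
  interpret P: bernoulli_process P X p by fact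
  interpret Q: bernoulli_process Q X q by fact
  show ?thesis
    \<comment> \<open>\<open>P\<close> and \<open>Q\<close> come without a joint law, so both sides
      are first expressed through coin products, for which the coupling is available.\<close>
    unfolding P.prob_upper_stop_eq_Pi_pmf[OF \<open>n \<ge> 1\<close>] Q.prob_upper_stop_eq_Pi_pmf[OF \<open>n \<ge> 1\<close>]
  proof (rule Pi_pmf_bernoulli_mono(1))
    fix f g :: "nat \<Rightarrow> bool"
    assume "\<And>i. f i \<Longrightarrow> g i" and "f \<in> {f. upper_stop (\<lambda>i f. f i) U L (enat (Suc n)) f}"
    then show "g \<in> {f. upper_stop (\<lambda>i f. f i) U L (enat (Suc n)) f}"
      using upper_stop_mono[OF S_mono, of _ "\<lambda>i f. f i" f "\<lambda>i f. f i" g] by simp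
  qed (use P.p Q.p \<open>p \<le> q\<close> in auto)
qed

lemma prob_lower_stop_antimono:
  assumes "bernoulli_process P X p" and "bernoulli_process Q X q" and "p \<le> q" and "n \<ge> 1"
  shows "measure Q {\<omega> \<in> space Q. lower_stop X U L (enat (Suc n)) \<omega>} \<le>
    measure P {\<omega> \<in> space P. lower_stop X U L (enat (Suc n)) \<omega>}"
proof -
  interpret P: bernoulli_process P X p by fact
  interpret Q: bernoulli_process Q X q by fact
  show ?thesis
    unfolding P.prob_lower_stop_eq_Pi_pmf[OF \<open>n \<ge> 1\<close>] Q.prob_lower_stop_eq_Pi_pmf[OF \<open>n \<ge> 1\<close>]
  proof (rule Pi_pmf_bernoulli_mono(2))
    fix f g :: "nat \<Rightarrow> bool"
    assume "\<And>i. f i \<Longrightarrow> g i" and "g \<in> {f. lower_stop (\<lambda>i f. f i) U L (enat (Suc n)) f}"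
    then show "f \<in> {f. lower_stop (\<lambda>i f. f i) U L (enat (Suc n)) f}"
      using lower_stop_mono[OF S_mono, of _ "\<lambda>i f. f i" f "\<lambda>i f. f i" g] by simp
  qed (use P.p Q.p \<open>p \<le> q\<close> in auto)
qed

section \<open>The boundaries built under \<alpha>\<close>

locale spending_boundaries = bernoulli_process P X \<alpha>
  for P :: "'a measure" and X and \<alpha> :: real +
  fixes e :: "nat \<Rightarrow> real" and \<epsilon> :: real
  assumes alpha: "\<alpha> \<in> {0<..<1}"
    and e_mono: "mono_on {1..} e"
    and e_bounds: "\<And>n. n \<ge> 1 \<Longrightarrow> 0 \<le> e n \<and> e n < \<epsilon>"
    and eps_half: "\<epsilon> < 1/2"
begin

abbreviation "U \<equiv> upper_bd P X e"
abbreviation "L \<equiv> lower_bd P X e"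
abbreviation "prob_upper n \<equiv> prob {\<omega> \<in> space P. upper_stop X U L (enat n) \<omega>}"
abbreviation "prob_lower n \<equiv> prob {\<omega> \<in> space P. lower_stop X U L (enat n) \<omega>}"

text \<open>Source of contradictions: the two stopping probabilities will be below 1/2 each, so
  \<open>Q\<close> cannot be too unlikely.\<close>

lemma one_le_prob_upper_lower:
  assumes "\<And>\<omega>. \<omega> \<in> space P \<Longrightarrow> Q \<omega> \<or> lower_stop X U L (enat n) \<omega> \<or> upper_stop X U L (enat n) \<omega>"
    and [measurable]: "Measurable.pred P Q"
  shows "1 \<le> prob {\<omega> \<in> space P. Q \<omega>} + prob_lower n + prob_upper n"
proof -
  have "1 = prob (space P)"
    by (simp add: prob_space)
  also have "space P = {\<omega> \<in> space P. Q \<omega>} \<union> {\<omega> \<in> space P. lower_stop X U L (enat n) \<omega>} \<union>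
      {\<omega> \<in> space P. upper_stop X U L (enat n) \<omega>}"
    using assms(1) by blast
  also have "prob \<dots> \<le> prob ({\<omega> \<in> space P. Q \<omega>} \<union> {\<omega> \<in> space P. lower_stop X U L (enat n) \<omega>}) +
      prob_upper n"
    by (rule measure_Un_le) auto
  also have "\<dots> \<le> prob {\<omega> \<in> space P. Q \<omega>} + prob_lower n + prob_upper n"
    by (intro add_right_mono measure_Un_le) auto
  finally show ?thesis .
qed

text \<open>The minimum and maximum in the recursion are attained once the sets of admissible
  \<open>j\<close> are shown to be nonempty and bounded on the relevant side.\<close>

lemma boundary_step:
  assumes n: "n \<ge> 2" and upper: "prob_upper n \<le> e n" and lower: "prob_lower n \<le> e n"
  shows "upper_spent P X U L n (U n) \<le> e n" and "lower_spent P X U L n (L n) \<le> e n"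
    and "1 \<le> j \<Longrightarrow> upper_spent P X U L n j \<le> e n \<Longrightarrow> U n \<le> j"
    and "lower_spent P X U L n j \<le> e n \<Longrightarrow> j \<le> L n"
proof -
  let ?Q = "\<lambda>j. 1 \<le> j \<and> upper_spent P X U L n j \<le> e n"
  \<comment> \<open>The walk cannot reach \<open>int n + 1\<close>, so this candidate costs nothing
    beyond what was already spent; \<open>-1\<close> plays the same role for
    \<open>L n\<close>.\<close>
  have "{\<omega> \<in> space P. enat n \<le> tau X U L \<omega> \<and> int n + 1 \<le> S X n \<omega>} = {}"
    using S_le[of X n] by (auto simp: not_le intro: le_less_trans)
  then have Q: "?Q (int n + 1)"
    using upper unfolding upper_spent_def by (simp only: measure_empty) simp
  note least = int_LeastI[where P = ?Q and a = 1, folded upper_bd_rec[OF n]]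
  show "upper_spent P X U L n (U n) \<le> e n"
    using least(1)[OF Q] by blast
  show "U n \<le> j" if "1 \<le> j" "upper_spent P X U L n j \<le> e n"
    using least(2)[of j] that by blast
  let ?R = "\<lambda>j. lower_spent P X U L n j \<le> e n"
  have "{\<omega> \<in> space P. enat n \<le> tau X U L \<omega> \<and> S X n \<omega> \<le> -1} = {}"
    using S_nonneg[of X n] by (auto simp: not_le[of "S X n _"] intro: less_le_trans[of _ 0])
  then have R: "?R (-1)"
    using lower unfolding lower_spent_def by (simp only: measure_empty)
  \<comment> \<open>Unlike \<open>U n\<close>, whose candidates satisfy \<open>1 \<le> j\<close>,
    the candidates for \<open>L n\<close> carry no explicit bound. For \<open>j\<close> above
    \<open>n\<close> all surviving paths count, so \<open>lower_spent\<close> and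
    \<open>prob_upper n\<close> together reach 1, although they are at most
    \<open>2 * e n < 1\<close>.\<close>
  have bound: "j \<le> int n" if "?R j" for j
  proof (rule ccontr)
    assume "\<not> j \<le> int n"
    then have "S X n \<omega> \<le> j" for \<omega>
      using S_le[of X n \<omega>] by linarith
    then have "1 \<le> prob {\<omega> \<in> space P. enat n \<le> tau X U L \<omega> \<and> S X n \<omega> \<le> j} + prob_lower n + prob_upper n"
      using upper_or_lower_stop[of X U L _ "enat n"]
      by (intro one_le_prob_upper_lower) (auto simp: not_le[symmetric])
    also have "\<dots> \<le> e n + e n"
      using that upper unfolding lower_spent_def by linarith
    finally show False
      using e_bounds[of n] eps_half n by simp
  qed
  note greatest = int_GreatestI[where P = ?R and b = "int n", folded lower_bd_rec[OF n]]
  show "lower_spent P X U L n (L n) \<le> e n"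
    using greatest(1)[OF R bound] by blast
  show "j \<le> L n" if "lower_spent P X U L n j \<le> e n"
    using greatest(2)[OF that bound] by blast
qed

text \<open>Induction that carries the spending bound along with the existence of the next boundary
  values: the bound at \<open>n\<close> and monotonicity of \<open>e\<close> supply the premises of
  \<open>boundary_step\<close> at \<open>Suc n\<close>, which returns the bound there.\<close>

lemma prob_stop_Suc_le:
  assumes "n \<ge> 1"
  shows "prob_upper (Suc n) \<le> e n \<and> prob_lower (Suc n) \<le> e n"
  using assms
proof (induction n rule: nat_induct_at_least)
  case base
  \<comment> \<open>The initial values 2 and -1 are out of reach at time 1, so nothing is spent
    there and the bound holds even for \<open>e 1 = 0\<close>.\<close>
  have "\<not> upper_stop X U L (enat (Suc 1)) \<omega>" for \<omega>
  proof -
    have "\<not> U 1 \<le> S X 1 \<omega>"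
      using S_le[of X 1 \<omega>] upper_bd_1[of P X e] by simp
    moreover have "k = 1" if "1 \<le> k" "enat k < enat (Suc 1)" for k
      using that by simp
    ultimately show ?thesis
      unfolding upper_stop_iff by blast
  qed
  moreover have "\<not> lower_stop X U L (enat (Suc 1)) \<omega>" for \<omega>
  proof -
    have "\<not> S X 1 \<omega> \<le> L 1"
      using S_nonneg[of X 1 \<omega>] lower_bd_1[of P X e] by simp
    moreover have "k = 1" if "1 \<le> k" "enat k < enat (Suc 1)" for k
      using that by simp
    ultimately show ?thesis
      unfolding lower_stop_iff by blast
  qed
  ultimately show ?case
    using e_bounds[of 1] by simp
next
  case (Suc n)
  have "e n \<le> e (Suc n)"
    using e_mono Suc.hyps by (auto simp: mono_on_def)
  with Suc have "prob_upper (Suc n) \<le> e (Suc n)" "prob_lower (Suc n) \<le> e (Suc n)"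
    by auto
  from boundary_step(1,2)[OF _ this] Suc.hyps show ?case
    by (simp add: prob_upper_stop_Suc prob_lower_stop_Suc)
qed

lemma prob_stop_le:
  assumes "n \<ge> 2"
  shows "prob_upper n \<le> e (n - 1)" "prob_lower n \<le> e (n - 1)" "e (n - 1) \<le> e n"
  using prob_stop_Suc_le[of "n - 1"] assms e_mono by (auto simp: mono_on_def)

text \<open>Past spending is at most \<open>e (n - 1)\<close>, so the increment
  \<open>e n - e (n - 1)\<close> is available at time \<open>n\<close>; dropping the survival
  condition only enlarges the cost of \<open>j\<close>.\<close>

lemma U_le:
  assumes "n \<ge> 2" "1 \<le> j" "prob {\<omega> \<in> space P. S X n \<omega> \<ge> j} \<le> e n - e (n - 1)"
  shows "U n \<le> j"
proof -
  note s = prob_stop_le[OF assms(1)]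
  have "prob {\<omega> \<in> space P. enat n \<le> tau X U L \<omega> \<and> S X n \<omega> \<ge> j} \<le> prob {\<omega> \<in> space P. S X n \<omega> \<ge> j}"
    by (intro finite_measure_mono) auto
  then have "upper_spent P X U L n j \<le> e n"
    using assms(3) s unfolding upper_spent_def by linarith
  with s assms(1,2) show ?thesis
    by (intro boundary_step(3)) auto
qed

lemma L_ge:
  assumes "n \<ge> 2" "prob {\<omega> \<in> space P. S X n \<omega> \<le> j} \<le> e n - e (n - 1)"
  shows "j \<le> L n"
proof -
  note s = prob_stop_le[OF assms(1)]
  have "prob {\<omega> \<in> space P. enat n \<le> tau X U L \<omega> \<and> S X n \<omega> \<le> j} \<le> prob {\<omega> \<in> space P. S X n \<omega> \<le> j}"
    by (intro finite_measure_mono) auto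
  then have "lower_spent P X U L n j \<le> e n"
    using assms(2) s unfolding lower_spent_def by linarith
  with s assms(1) show ?thesis
    by (intro boundary_step(4)) auto
qed

text \<open>Otherwise the walk would surely have stopped by time \<open>n\<close>, but the probability of this
  is at most \<open>2 * e n < 1\<close>.\<close>

lemma L_less_U:
  assumes "n \<ge> 1"
  shows "L n < U n"
proof (rule ccontr)
  assume *: "\<not> L n < U n"
  have "tau X U L \<omega> < enat (Suc n)" for \<omega>
    unfolding tau_less_iff using assms * by (intro exI[of _ n]) auto
  then have "1 \<le> prob {\<omega> \<in> space P. False} + prob_lower (Suc n) + prob_upper (Suc n)"
    using upper_or_lower_stop[of X U L _ "enat (Suc n)"]
    by (intro one_le_prob_upper_lower) auto
  then show False
    using prob_stop_Suc_le[OF assms] e_bounds[OF assms] eps_half by simp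
qed

lemma boundaries_linear:
  assumes incr: "\<forall>\<^sub>F n in sequentially. e n > e (n - 1)"
    and log: "(\<lambda>n. ln (e n - e (n - 1))) \<in> o(\<lambda>n. real n)"
    and "d > 0"
  shows "\<forall>\<^sub>F n in sequentially.
    \<bar>real_of_int (U n) - \<alpha> * real n\<bar> \<le> d * real n \<and> \<bar>\<alpha> * real n - real_of_int (L n)\<bar> \<le> d * real n"
proof -
  \<comment> \<open>One half of \<open>d\<close> goes into Hoeffding's inequality, the other absorbs
    the rounding error of at most 1.\<close>
  define c where "c = d / 2"
  have c: "c > 0" using \<open>d > 0\<close> by (simp add: c_def)
  \<comment> \<open>The constant is the rate in Hoeffding's bound at deviation
    \<open>c\<close>.\<close>
  have "\<forall>\<^sub>F n in sequentially. norm (ln (e n - e (n - 1))) \<le> 2 * c\<^sup>2 * norm (real n)"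
    using c by (intro landau_o.smallD[OF log]) simp
  moreover have "\<forall>\<^sub>F n in sequentially. real n \<ge> 1 / c"
    using filterlim_real_sequentially by (simp add: filterlim_at_top)
  moreover have "\<forall>\<^sub>F n :: nat in sequentially. n \<ge> 2"
    by (rule eventually_ge_at_top)
  ultimately show ?thesis
    using incr
  proof eventually_elim
    case (elim n)
    have "- (2 * c\<^sup>2 * real n) \<le> ln (e n - e (n - 1))"
      using elim(1) by (simp add: abs_le_iff)
    then have exp_le: "exp (- 2 * c\<^sup>2 * real n) \<le> e n - e (n - 1)"
      using elim(4) by (subst ln_ge_iff[symmetric]) auto
    have "n \<ge> 1" using elim(3) by simp
    have "prob {\<omega> \<in> space P. S X n \<omega> \<ge> \<lceil>(\<alpha> + c) * real n\<rceil>} \<le> e n - e (n - 1)"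
      using Hoeffding_S(1)[OF \<open>n \<ge> 1\<close>, of c] exp_le c by (simp add: ceiling_le_iff)
    \<comment> \<open>Ensures that the rounded value is at least 1, as \<open>U_le\<close> asks of a
      candidate.\<close>
    moreover have "0 < (\<alpha> + c) * real n"
      using alpha c elim(3) by simp
    ultimately have "U n \<le> \<lceil>(\<alpha> + c) * real n\<rceil>"
      using elim(3) by (intro U_le) auto
    then have U: "real_of_int (U n) \<le> (\<alpha> + c) * real n + 1"
      by linarith
    have "prob {\<omega> \<in> space P. S X n \<omega> \<le> \<lfloor>(\<alpha> - c) * real n\<rfloor>} \<le> e n - e (n - 1)"
      using Hoeffding_S(2)[OF \<open>n \<ge> 1\<close>, of c] exp_le c by (simp add: le_floor_iff)
    then have "\<lfloor>(\<alpha> - c) * real n\<rfloor> \<le> L n"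
      using elim(3) by (intro L_ge) auto
    then have L: "(\<alpha> - c) * real n - 1 \<le> real_of_int (L n)"
      by linarith
    have "1 \<le> c * real n"
      using elim(2) c by (simp add: field_simps)
    \<comment> \<open>Hoeffding bounds \<open>U n\<close> only from above and \<open>L n\<close>
      only from below; this inequality turns each bound into the missing one for the other
      boundary.\<close>
    moreover have "real_of_int (L n) < real_of_int (U n)"
      using L_less_U[OF \<open>n \<ge> 1\<close>] by simp
    moreover have "d * real n = c * real n + c * real n"
      by (simp add: c_def)
    ultimately show ?case
      using U L unfolding distrib_right left_diff_distrib by linarith
  qed
qed

end

section \<open>Finite expected stopping time away from \<alpha>\<close>

lemma (in bernoulli_process) expectation_tau_finite_upper:
  assumes "p > \<alpha>" and "\<And>d. d > 0 \<Longrightarrow> \<forall>\<^sub>F n in sequentially. \<bar>real_of_int (U n) - \<alpha> * real n\<bar> \<le> d * real n"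
  shows "(\<integral>\<^sup>+ \<omega>. ennreal_of_enat (tau X U L \<omega>) \<partial>P) < \<infinity>"
proof -
  \<comment> \<open>With half the gap, \<open>\<alpha> + d = p - d\<close>: a walk surviving past
    \<open>n\<close> lies below \<open>U n\<close>, hence deviates from its mean by at least
    \<open>d * n\<close>.\<close>
  define d where "d = (p - \<alpha>) / 2"
  have d: "d > 0" using assms(1) by (simp add: d_def)
  have "\<forall>\<^sub>F n in sequentially. prob {\<omega> \<in> space P. enat n < tau X U L \<omega>} \<le> exp (- (2 * d\<^sup>2) * real n)"
    using assms(2)[OF d] eventually_ge_at_top[of 1]
  proof eventually_elim
    case (elim n)
    have "(\<alpha> + d) * real n = (p - d) * real n"
      by (simp add: d_def field_simps)
    then have U: "real_of_int (U n) \<le> (p - d) * real n"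
      using elim(1) by (simp add: algebra_simps abs_le_iff)
    have "S X n \<omega> < U n" if "enat n < tau X U L \<omega>" for \<omega>
      using that elim(2) tau_ge_iff[of "Suc n" X U L \<omega>] by (simp add: Suc_ile_eq)
    then have "prob {\<omega> \<in> space P. enat n < tau X U L \<omega>} \<le>
        prob {\<omega> \<in> space P. real_of_int (S X n \<omega>) \<le> (p - d) * real n}"
      using U by (intro finite_measure_mono) force+
    also have "\<dots> \<le> exp (- 2 * d\<^sup>2 * real n)"
      using elim(2) d by (intro Hoeffding_S(2)) auto
    finally show ?case by simp
  qed
  then show ?thesis
    using d by (intro expectation_tau_finite[where c = "2 * d\<^sup>2"]) auto
qed

lemma (in bernoulli_process) expectation_tau_finite_lower:
  assumes "p < \<alpha>" and "\<And>d. d > 0 \<Longrightarrow> \<forall>\<^sub>F n in sequentially. \<bar>\<alpha> * real n - real_of_int (L n)\<bar> \<le> d * real n"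
  shows "(\<integral>\<^sup>+ \<omega>. ennreal_of_enat (tau X U L \<omega>) \<partial>P) < \<infinity>"
proof -
  define d where "d = (\<alpha> - p) / 2"
  have d: "d > 0" using assms(1) by (simp add: d_def)
  have "\<forall>\<^sub>F n in sequentially. prob {\<omega> \<in> space P. enat n < tau X U L \<omega>} \<le> exp (- (2 * d\<^sup>2) * real n)"
    using assms(2)[OF d] eventually_ge_at_top[of 1]
  proof eventually_elim
    case (elim n)
    have "(\<alpha> - d) * real n = (p + d) * real n"
      by (simp add: d_def field_simps)
    then have L: "(p + d) * real n \<le> real_of_int (L n)"
      using elim(1) by (simp add: algebra_simps abs_le_iff)
    have "L n < S X n \<omega>" if "enat n < tau X U L \<omega>" for \<omega>
      using that elim(2) tau_ge_iff[of "Suc n" X U L \<omega>] by (simp add: Suc_ile_eq)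
    then have "prob {\<omega> \<in> space P. enat n < tau X U L \<omega>} \<le>
        prob {\<omega> \<in> space P. real_of_int (S X n \<omega>) \<ge> (p + d) * real n}"
      using L by (intro finite_measure_mono) force+
    also have "\<dots> \<le> exp (- 2 * d\<^sup>2 * real n)"
      using elim(2) d by (intro Hoeffding_S(1)) auto
    finally show ?case by simp
  qed
  then show ?thesis
    using d by (intro expectation_tau_finite[where c = "2 * d\<^sup>2"]) auto
qed

theorem theorem1:
  fixes M :: "real \<Rightarrow> 'a measure"
    and X :: "nat \<Rightarrow> 'a \<Rightarrow> bool"
    and \<alpha> \<epsilon> :: real
    and e :: "nat \<Rightarrow> real"
    and U L :: "nat \<Rightarrow> int"
  assumes prob: "\<And>p. p \<in> {0..1} \<Longrightarrow> prob_space (M p)"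
    and indep: "\<And>p. p \<in> {0..1} \<Longrightarrow>
      prob_space.indep_vars (M p) (\<lambda>_. count_space UNIV) X {1..}"
    and bernoulli: "\<And>p i. p \<in> {0..1} \<Longrightarrow> i \<ge> 1 \<Longrightarrow>
      distr (M p) (count_space UNIV) (X i) = measure_pmf (bernoulli_pmf p)"
    and alpha: "\<alpha> \<in> {0<..<1}"
    and eps_pos: "\<epsilon> > 0"
    and e_mono: "mono_on {1..} e"
    and e_bounds: "\<And>n. n \<ge> 1 \<Longrightarrow> 0 \<le> e n \<and> e n < \<epsilon>"
    and e_lim: "e \<longlonglongrightarrow> \<epsilon>"
    and U: "U = upper_bd (M \<alpha>) X e"
    and L: "L = lower_bd (M \<alpha>) X e"
    and eps_half: "\<epsilon> < 1/2"
    and e_incr: "\<forall>\<^sub>F n in sequentially. e n > e (n - 1)"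
    and e_log: "(\<lambda>n. ln (e n - e (n - 1))) \<in> o(\<lambda>n. real n)"
  shows "(\<lambda>n. real_of_int (U n) - \<alpha> * real n) \<in> o(\<lambda>n. real n)
    \<and> (\<lambda>n. \<alpha> * real n - real_of_int (L n)) \<in> o(\<lambda>n. real n)
    \<and> (\<forall>p\<in>{0..1}. p \<noteq> \<alpha> \<longrightarrow>
          (\<integral>\<^sup>+ \<omega>. ennreal_of_enat (tau X U L \<omega>) \<partial>M p) < \<infinity>)
    \<and> (SUP p\<in>{0..\<alpha>}. measure (M p) {\<omega> \<in> space (M p). upper_stop X U L \<infinity> \<omega>}) \<le> \<epsilon>
    \<and> (SUP p\<in>{\<alpha><..1}. measure (M p) {\<omega> \<in> space (M p). lower_stop X U L \<infinity> \<omega>}) \<le> \<epsilon>"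
proof -
  have process: "bernoulli_process (M p) X p" if "p \<in> {0..1}" for p
    using prob[OF that] indep[OF that] bernoulli[OF that] that
    by (intro bernoulli_process.intro bernoulli_process_axioms.intro) auto
  have \<alpha>01: "\<alpha> \<in> {0..1}" using alpha by simp
  \<comment> \<open>Only \<open>M \<alpha>\<close> enters the construction; for other
    \<open>p\<close> the boundaries are fixed sequences known to be asymptotically linear.\<close>
  interpret A: spending_boundaries "M \<alpha>" X \<alpha> e \<epsilon>
    using process[OF \<alpha>01] alpha e_mono e_bounds eps_half
    by (intro spending_boundaries.intro spending_boundaries_axioms.intro) auto
  note linear = A.boundaries_linear[OF e_incr e_log, folded U L]
  have linU: "\<forall>\<^sub>F n in sequentially. \<bar>real_of_int (U n) - \<alpha> * real n\<bar> \<le> d * real n" if "d > 0" for d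
    using linear[OF that] by (rule eventually_mono) blast
  have linL: "\<forall>\<^sub>F n in sequentially. \<bar>\<alpha> * real n - real_of_int (L n)\<bar> \<le> d * real n" if "d > 0" for d
    using linear[OF that] by (rule eventually_mono) blast
  have stop: "measure (M \<alpha>) {\<omega> \<in> space (M \<alpha>). upper_stop X U L (enat (Suc n)) \<omega>} \<le> \<epsilon>"
    "measure (M \<alpha>) {\<omega> \<in> space (M \<alpha>). lower_stop X U L (enat (Suc n)) \<omega>} \<le> \<epsilon>" if "n \<ge> 1" for n
    using A.prob_stop_Suc_le[OF that, folded U L] e_bounds[OF that] by auto
  have "(\<lambda>n. real_of_int (U n) - \<alpha> * real n) \<in> o(\<lambda>n. real n)"
    using linU by (intro landau_o.smallI) simp
  moreover have "(\<lambda>n. \<alpha> * real n - real_of_int (L n)) \<in> o(\<lambda>n. real n)"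
    using linL by (intro landau_o.smallI) simp
  moreover have "(\<integral>\<^sup>+ \<omega>. ennreal_of_enat (tau X U L \<omega>) \<partial>M p) < \<infinity>"
    if "p \<in> {0..1}" "p \<noteq> \<alpha>" for p
  proof (cases "p < \<alpha>")
    case True
    then show ?thesis
      using linL by (rule bernoulli_process.expectation_tau_finite_lower[OF process[OF that(1)]])
  next
    case False
    with that(2) have "p > \<alpha>" by simp
    then show ?thesis
      using linU by (rule bernoulli_process.expectation_tau_finite_upper[OF process[OF that(1)]])
  qed
  \<comment> \<open>For each finite time the probability at \<open>p\<close> is compared with the
    one at \<alpha>, and the common bound \<epsilon> then passes to infinite time.
    \<open>cSUP_least\<close> needs a nonempty index set, provided by the range of \<alpha>.\<close>
  moreover have "(SUP p\<in>{0..\<alpha>}. measure (M p) {\<omega> \<in> space (M p). upper_stop X U L \<infinity> \<omega>}) \<le> \<epsilon>"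
  proof (rule cSUP_least)
    fix p assume p: "p \<in> {0..\<alpha>}"
    then have P: "bernoulli_process (M p) X p"
      using alpha by (intro process) auto
    show "measure (M p) {\<omega> \<in> space (M p). upper_stop X U L \<infinity> \<omega>} \<le> \<epsilon>"
      using prob_upper_stop_mono[OF P process[OF \<alpha>01], of _ U L] stop(1) p
      by (intro bernoulli_process.prob_upper_stop_infinity_le[OF P]) (auto intro: order_trans)
  qed (use alpha in auto)
  moreover have "(SUP p\<in>{\<alpha><..1}. measure (M p) {\<omega> \<in> space (M p). lower_stop X U L \<infinity> \<omega>}) \<le> \<epsilon>"
  proof (rule cSUP_least)
    fix p assume p: "p \<in> {\<alpha><..1}"
    then have P: "bernoulli_process (M p) X p"
      using alpha by (intro process) auto
    show "measure (M p) {\<omega> \<in> space (M p). lower_stop X U L \<infinity> \<omega>} \<le> \<epsilon>"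
      using prob_lower_stop_antimono[OF process[OF \<alpha>01] P, of _ U L] stop(2) p
      by (intro bernoulli_process.prob_lower_stop_infinity_le[OF P]) (auto intro: order_trans)
  qed (use alpha in auto)
  ultimately show ?thesis
    by blast
qed

end
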